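(* For every real $\varepsilon$ with $0<\varepsilon<\frac14$ there is $n_0$ such that for every integer $n\ge n_0$ and every positive integer $b\le\left(\frac14-\varepsilon\right)\frac{n}{\ln n}$, Walker has a winning strategy in the $(2:b)$ Walker--Breaker Connectivity game played on $E(K_n)$; that is, Walker has a strategy guaranteeing that, against any play of Breaker, she claims all the edges of some spanning tree of $K_n$ by the end of the game.
   Context: The $(2:b)$ Walker--Breaker game on $E(K_n)$ (the edge set of the complete graph on $n$ vertices) is played by two players, Walker and Breaker, who alternately move, until all edges of $K_n$ are claimed. In each of his moves Breaker claims $b$ edges not yet claimed by either player (or all remaining unclaimed edges if there are fewer than $b$). Walker must choose her edges according to a walk: at her first move she chooses any vertex of $K_n$ as her starting position; each of her moves consists of two successive steps, where in one step, being positioned at a vertex $v$, she chooses an edge $vw$ not previously claimed by Breaker (it may be unclaimed or already claimed by Walker herself), claims it if it was unclaimed, and $w$ becomes her current position. Each subsequent step starts at her current position, also from one move to the next. In the Connectivity game the winning sets are the edge sets of spanning trees of $K_n$. Walker wins if by the end of the game she has claimed all edges of some winning set; otherwise Breaker wins. Convention for this result: Breaker is the first player, i.e. each round consists of a move of Breaker followed by a move of Walker (so Walker chooses her starting position after Breaker's first move). *)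

theory Defs
  imports Complex_Main
begin

type_synonym edge = "nat set"

text \<open>The complete graph on \<open>n\<close> vertices has vertex set \<open>{..<n}\<close>; edges are two-element sets.\<close>

definition complete_edges :: "nat \<Rightarrow> edge set" where
  "complete_edges n = {{u, v} | u v. u < n \<and> v < n \<and> u \<noteq> v}"

definition connected_on :: "nat \<Rightarrow> edge set \<Rightarrow> bool" where
  "connected_on n T \<longleftrightarrow> (\<forall>u<n. \<forall>v<n. (u, v) \<in> {(x, y). {x, y} \<in> T}\<^sup>*)"

text \<open>A cycle \<open>v\<^sub>0 v\<^sub>1 \<dots> v\<^sub>k v\<^sub>0\<close> is represented by the list of its distinct vertices,
  the closing edge being supplied by the index arithmetic.\<close>

definition is_cycle :: "edge set \<Rightarrow> nat list \<Rightarrow> bool" where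
  "is_cycle T vs \<longleftrightarrow> 3 \<le> length vs \<and> distinct vs \<and>
     (\<forall>i<length vs. {vs ! i, vs ! (Suc i mod length vs)} \<in> T)"

definition spanning_trees :: "nat \<Rightarrow> edge set set" where
  "spanning_trees n =
     {T. T \<subseteq> complete_edges n \<and> connected_on n T \<and> \<not> (\<exists>vs. is_cycle T vs)}"


text \<open>\<open>location\<close> is \<open>None\<close> until Walker has chosen her starting vertex.\<close>

record game_state =
  breaker_edges :: "edge set"
  walker_edges :: "edge set"
  location :: "nat option"

definition initial_state :: game_state where
  "initial_state = \<lparr>breaker_edges = {}, walker_edges = {}, location = None\<rparr>"

definition unclaimed :: "nat \<Rightarrow> game_state \<Rightarrow> edge set" where
  "unclaimed n s = complete_edges n - (breaker_edges s \<union> walker_edges s)"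

text \<open>\<open>Walk x y z\<close> is the move in which Walker, standing at \<open>x\<close>, steps to \<open>y\<close> and then to \<open>z\<close>.
  In her first move, \<open>x\<close> is the starting vertex of her choice.\<close>

datatype walker_move = Walk nat nat nat

datatype move = B "edge set" | W walker_move

definition breaker_legal :: "nat \<Rightarrow> nat \<Rightarrow> game_state \<Rightarrow> edge set \<Rightarrow> bool" where
  "breaker_legal n b s X \<longleftrightarrow> X \<subseteq> unclaimed n s \<and> card X = min b (card (unclaimed n s))"

text \<open>A legal move of Walker exists whenever some edge is unclaimed: on her first move she can
  start at an endpoint of it, and afterwards she can walk back along the edge she last used.\<close>

fun walker_legal :: "nat \<Rightarrow> game_state \<Rightarrow> walker_move \<Rightarrow> bool" where
  "walker_legal n s (Walk x y z) \<longleftrightarrow>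
     (case location s of None \<Rightarrow> x < n | Some v \<Rightarrow> x = v) \<and>
     {x, y} \<in> complete_edges n - breaker_edges s \<and>
     {y, z} \<in> complete_edges n - breaker_edges s"

definition after_breaker :: "game_state \<Rightarrow> edge set \<Rightarrow> game_state" where
  "after_breaker s X = s\<lparr>breaker_edges := breaker_edges s \<union> X\<rparr>"

fun after_walker :: "game_state \<Rightarrow> walker_move \<Rightarrow> game_state" where
  "after_walker s (Walk x y z) =
     s\<lparr>walker_edges := walker_edges s \<union> {{x, y}, {y, z}}, location := Some z\<rparr>"

text \<open>A strategy maps the history of the game, oldest move first, to Walker's next move.\<close>

type_synonym strategy = "move list \<Rightarrow> walker_move"

text \<open>\<open>play n b S h s\<close>: the history \<open>h\<close> leads to state \<open>s\<close>, arises from legal moves of Breaker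
  (with bias \<open>b\<close>), and has Walker following \<open>S\<close>.  Breaker moves first, hence it is his turn after
  an even number of moves.  Legality of Walker's moves is a requirement on \<open>S\<close>, imposed in
  \<open>winning_strategy\<close>.\<close>

inductive play :: "nat \<Rightarrow> nat \<Rightarrow> strategy \<Rightarrow> move list \<Rightarrow> game_state \<Rightarrow> bool"
  for n b :: nat and S :: strategy where
  start: "play n b S [] initial_state"
| breaker: "play n b S h s \<Longrightarrow> even (length h) \<Longrightarrow> unclaimed n s \<noteq> {} \<Longrightarrow> breaker_legal n b s X
    \<Longrightarrow> play n b S (h @ [B X]) (after_breaker s X)"
| walker: "play n b S h s \<Longrightarrow> odd (length h) \<Longrightarrow> unclaimed n s \<noteq> {}
    \<Longrightarrow> play n b S (h @ [W (S h)]) (after_walker s (S h))"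

text \<open>For \<open>b \<ge> 1\<close> every play ends after finitely many moves, since Breaker claims at least one
  edge in each of his moves.\<close>

definition winning_strategy :: "nat \<Rightarrow> nat \<Rightarrow> edge set set \<Rightarrow> strategy \<Rightarrow> bool" where
  "winning_strategy n b F S \<longleftrightarrow>
     (\<forall>h s. play n b S h s \<longrightarrow> odd (length h) \<longrightarrow> unclaimed n s \<noteq> {} \<longrightarrow> walker_legal n s (S h)) \<and>
     (\<forall>h s. play n b S h s \<longrightarrow> unclaimed n s = {} \<longrightarrow> (\<exists>T\<in>F. T \<subseteq> walker_edges s))"

end

theory Submission
  imports Defs
begin

text \<open>Walker wins as soon as her walk has visited every vertex, because the edges of a walk form a
  connected graph.  In each move she goes to an unvisited vertex \<open>u\<close> whose Breaker degree is
  maximal.  From her position \<open>x\<close> she gets there in two steps whenever some third vertex is joined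
  by Breaker neither to \<open>x\<close> nor to \<open>u\<close>, so it suffices that the Breaker degrees of \<open>x\<close> and \<open>u\<close> add
  up to less than \<open>n - 2\<close> (\<open>common_free_neighbour\<close>).

  The degrees of the unvisited vertices are controlled as in the box game.  The potential is the
  sum of \<open>exp (d u / (2 * b))\<close> over the unvisited vertices \<open>u\<close>, where \<open>d u\<close> is the Breaker degree.
  One move of Breaker increases the sum of the exponents by at most 1, since each of his \<open>b\<close> edges
  has two ends; by \<open>exp (- t) \<ge> 1 - t\<close>, this increases the potential by no more than its then
  largest term, and that is the term which Walker removes (\<open>sum_exp_without_max\<close>).  So the potential
  never exceeds its initial value \<open>n\<close> before a move of Breaker, and every unvisited vertex then has
  Breaker degree at most \<open>2 * b * ln n\<close>.  Allowing for the edges that Breaker adds before Walker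
  leaves her position, the two degrees add up to at most \<open>4 * b * ln n + 3 * b\<close>, which is less than
  \<open>n - 2\<close> for \<open>b \<le> (1/4 - \<epsilon>) * n / ln n\<close> and large \<open>n\<close>.

  The length of the game need not be tracked: a vertex of Breaker degree less than \<open>n - 1\<close> that
  Walker has not visited is incident with an unclaimed edge, so the game cannot end before all
  vertices are visited.\<close>

section \<open>Strategies from invariants\<close>

definition apply_move :: "game_state \<Rightarrow> move \<Rightarrow> game_state" where
  "apply_move s m = (case m of B X \<Rightarrow> after_breaker s X | W w \<Rightarrow> after_walker s w)"

definition state_after :: "move list \<Rightarrow> game_state" where
  "state_after h = foldl apply_move initial_state h"

lemma play_state_after: "play n b S h s \<Longrightarrow> s = state_after h"
  by (induction rule: play.induct) (auto simp: state_after_def apply_move_def)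

text \<open>\<open>P\<close> is the invariant when Breaker is to move, and \<open>Q\<close> the one when Walker is to move.
  Since the history determines the state, Walker can play by choosing in each state some
  move that restores \<open>P\<close>.\<close>

lemma winning_strategy_if_invariant:
  assumes init: "P initial_state"
    and breaker: "\<And>s X. P s \<Longrightarrow> breaker_legal n b s X \<Longrightarrow> Q (after_breaker s X)"
    and walker: "\<And>s. Q s \<Longrightarrow> unclaimed n s \<noteq> {} \<Longrightarrow> \<exists>m. walker_legal n s m \<and> P (after_walker s m)"
    and win: "\<And>s. P s \<or> Q s \<Longrightarrow> unclaimed n s = {} \<Longrightarrow> \<exists>T\<in>F. T \<subseteq> walker_edges s"
  shows "\<exists>S. winning_strategy n b F S"
proof -
  define good where "good s m \<longleftrightarrow> walker_legal n s m \<and> P (after_walker s m)" for s m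
  define S where "S h = (SOME m. good (state_after h) m)" for h
  have good: "good s (S h)" if "play n b S h s" "Q s" "unclaimed n s \<noteq> {}" for h s
    using someI_ex[of "good s"] walker[OF that(2,3)] play_state_after[OF that(1)]
    by (simp add: S_def good_def)
  have inv: "if even (length h) then P s else Q s" if "play n b S h s" for h s
    using that
  proof (induction rule: play.induct)
    case start
    show ?case using init by simp
  next
    case (breaker h s X)
    then show ?case using assms(2) by simp
  next
    case (walker h s)
    then show ?case using good[of h s] by (simp add: good_def)
  qed
  have "winning_strategy n b F S"
    unfolding winning_strategy_def
  proof (intro conjI allI impI)
    fix h s assume "play n b S h s" "odd (length h)" "unclaimed n s \<noteq> {}"
    then show "walker_legal n s (S h)" using inv[of h s] good[of h s] by (simp add: good_def)
  next
    fix h s assume "play n b S h s" "unclaimed n s = {}"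
    then show "\<exists>T\<in>F. T \<subseteq> walker_edges s" using inv[of h s] win[of s] by (metis (full_types))
  qed
  then show ?thesis by blast
qed

section \<open>Connectivity and spanning trees\<close>

abbreviation adj :: "edge set \<Rightarrow> (nat \<times> nat) set" where
  "adj T \<equiv> {(x, y). {x, y} \<in> T}"

lemma sym_adj: "sym (adj T)"
  by (auto simp: sym_def insert_commute)

text \<open>The closing edge of a cycle is redundant: the rest of the cycle joins its ends.\<close>

lemma connected_on_remove_cycle_edge:
  assumes conn: "connected_on n T" and cyc: "is_cycle T vs"
  shows "\<exists>e\<in>T. connected_on n (T - {e})"
proof -
  define k where "k = length vs - 1"
  have k: "length vs = Suc k" "2 \<le> k" and dist: "distinct vs"
    and edge: "\<And>i. i < length vs \<Longrightarrow> {vs ! i, vs ! (Suc i mod length vs)} \<in> T"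
    using cyc by (auto simp: is_cycle_def k_def)
  define e where "e = {vs ! k, vs ! 0}"
  have eT: "e \<in> T" using edge[of k] k by (simp add: e_def)
  let ?R = "adj (T - {e})"
  have path: "i \<le> k \<Longrightarrow> (vs ! 0, vs ! i) \<in> ?R\<^sup>*" for i
  proof (induction i)
    case (Suc i)
    have "{vs ! i, vs ! Suc i} \<in> T" using edge[of i] Suc.prems k by simp
    moreover have "{vs ! i, vs ! Suc i} \<noteq> e"
      using dist k Suc.prems by (auto simp: e_def doubleton_eq_iff nth_eq_iff_index_eq)
    ultimately have "(vs ! i, vs ! Suc i) \<in> ?R" by simp
    with Suc show ?case by (meson Suc_leD rtrancl.rtrancl_into_rtrancl)
  qed simp
  have "(vs ! 0, vs ! k) \<in> ?R\<^sup>*" using path by blast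
  moreover from this have "(vs ! k, vs ! 0) \<in> ?R\<^sup>*"
    using sym_rtrancl[OF sym_adj] by (metis symD)
  ultimately have "adj T \<subseteq> ?R\<^sup>*"
    by (auto simp: e_def doubleton_eq_iff)
  then have "(adj T)\<^sup>* \<subseteq> ?R\<^sup>*" by (rule rtrancl_subset_rtrancl)
  then have "connected_on n (T - {e})" using conn unfolding connected_on_def by blast
  with eT show ?thesis ..
qed

lemma spanning_tree_of_connected:
  assumes fin: "finite G" and "G \<subseteq> complete_edges n" and "connected_on n G"
  shows "\<exists>T\<in>spanning_trees n. T \<subseteq> G"
  using assms
proof (induction rule: finite_psubset_induct)
  case (psubset G)
  show ?case
  proof (cases "\<exists>vs. is_cycle G vs")
    case True
    then obtain e where e: "e \<in> G" "connected_on n (G - {e})"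
      using connected_on_remove_cycle_edge psubset.prems(2) by blast
    then have "\<exists>T\<in>spanning_trees n. T \<subseteq> G - {e}"
      using psubset.prems(1) by (intro psubset.IH) auto
    then show ?thesis by blast
  next
    case False
    then show ?thesis using psubset.prems by (auto simp: spanning_trees_def)
  qed
qed

definition edges_connected :: "edge set \<Rightarrow> bool" where
  "edges_connected G \<longleftrightarrow> (\<forall>u\<in>\<Union>G. \<forall>v\<in>\<Union>G. (u, v) \<in> (adj G)\<^sup>*)"

lemma edges_connected_insert:
  assumes "edges_connected G" and "x \<in> \<Union>G \<or> G = {}"
  shows "edges_connected (insert {x, y} G)"
proof -
  let ?R = "adj (insert {x, y} G)"
  have mono: "(adj G)\<^sup>* \<subseteq> ?R\<^sup>*" by (intro rtrancl_mono) auto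
  have to_x: "(u, x) \<in> ?R\<^sup>*" if "u \<in> \<Union>(insert {x, y} G)" for u
  proof (cases "u = x \<or> u = y")
    case True
    have "(y, x) \<in> ?R" by (simp add: insert_commute)
    then have "(y, x) \<in> ?R\<^sup>*" by (rule r_into_rtrancl)
    with True show ?thesis by auto
  next
    case False
    then have "u \<in> \<Union>G" using that by auto
    then have "(u, x) \<in> (adj G)\<^sup>*"
      using assms unfolding edges_connected_def by blast
    then show ?thesis using mono by blast
  qed
  have "(x, u) \<in> ?R\<^sup>*" if "u \<in> \<Union>(insert {x, y} G)" for u
    using to_x[OF that] sym_rtrancl[OF sym_adj] by (metis symD)
  with to_x show ?thesis unfolding edges_connected_def by (meson rtrancl_trans)
qed

section \<open>Degrees\<close>

definition degree :: "edge set \<Rightarrow> nat \<Rightarrow> nat" where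
  "degree G u = card {e \<in> G. u \<in> e}"

lemma finite_complete_edges: "finite (complete_edges n)"
  by (rule finite_subset[of _ "Pow {..<n}"]) (auto simp: complete_edges_def)

lemma complete_edges_iff: "{u, v} \<in> complete_edges n \<longleftrightarrow> u < n \<and> v < n \<and> u \<noteq> v"
  by (auto simp: complete_edges_def doubleton_eq_iff)

lemma degree_le_card: "finite G \<Longrightarrow> degree G u \<le> card G"
  unfolding degree_def by (rule card_mono) auto

lemma degree_Un_le:
  assumes "finite G" "finite H"
  shows "degree (G \<union> H) u \<le> degree G u + degree H u"
proof -
  have "{e \<in> G \<union> H. u \<in> e} = {e \<in> G. u \<in> e} \<union> {e \<in> H. u \<in> e}" by blast
  then show ?thesis unfolding degree_def by (simp add: card_Un_le)
qed

lemma card_neighbours_le_degree: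
  assumes "finite G"
  shows "card {w. {u, w} \<in> G} \<le> degree G u"
  unfolding degree_def
proof (rule card_inj_on_le)
  show "inj_on (\<lambda>w. {u, w}) {w. {u, w} \<in> G}" by (auto simp: inj_on_def doubleton_eq_iff)
qed (use assms in auto)

lemma finite_neighbours:
  assumes "finite G"
  shows "finite {w. {u, w} \<in> G}"
  by (rule finite_imageD[of "\<lambda>w. {u, w}"])
    (auto intro: finite_subset[OF _ assms] simp: inj_on_def doubleton_eq_iff)

lemma sum_degree_le:
  assumes "X \<subseteq> complete_edges n" "finite A"
  shows "(\<Sum>u\<in>A. degree X u) \<le> 2 * card X"
proof -
  have fin: "finite X" using assms finite_complete_edges finite_subset by blast
  have "(\<Sum>u\<in>A. degree X u) = (\<Sum>u\<in>A. \<Sum>e\<in>X. if u \<in> e then 1 else 0)"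
    using fin by (simp add: degree_def sum.If_cases Int_def)
  also have "\<dots> = (\<Sum>e\<in>X. card (A \<inter> e))"
    using assms(2) by (subst sum.swap) (simp add: sum.If_cases Int_def)
  also have "\<dots> \<le> (\<Sum>e\<in>X. 2)"
  proof (rule sum_mono)
    fix e assume "e \<in> X"
    then obtain u v where e: "e = {u, v}" "u \<noteq> v" using assms(1) by (auto simp: complete_edges_def)
    have "card (A \<inter> e) \<le> card e" using e by (intro card_mono) auto
    then show "card (A \<inter> e) \<le> 2" using e by simp
  qed
  finally show ?thesis by simp
qed

lemma common_free_neighbour:
  assumes "finite G" and "degree G x + degree G u + 2 < n"
  shows "\<exists>w<n. w \<noteq> x \<and> w \<noteq> u \<and> {x, w} \<notin> G \<and> {w, u} \<notin> G"
proof (rule ccontr)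
  assume "\<not> ?thesis"
  then have "{..<n} \<subseteq> {x, u} \<union> ({w. {x, w} \<in> G} \<union> {w. {u, w} \<in> G})"
    by (auto simp: insert_commute)
  then have "card {..<n} \<le> card ({x, u} \<union> ({w. {x, w} \<in> G} \<union> {w. {u, w} \<in> G}))"
    using finite_neighbours[OF assms(1)] by (intro card_mono) auto
  also have "\<dots> \<le> card {x, u} + (card {w. {x, w} \<in> G} + card {w. {u, w} \<in> G})"
    by (meson card_Un_le add_left_mono order_trans)
  also have "\<dots> \<le> 2 + (degree G x + degree G u)"
    using card_neighbours_le_degree[OF assms(1)] by (intro add_mono) (auto simp: card_insert_if)
  finally show False using assms(2) by simp
qed

section \<open>The potential\<close>

text \<open>With exponents \<open>f\<close> before and \<open>f + c\<close> after a move of Breaker, and \<open>M\<close> the largest new term,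
  \<open>exp (f a) = exp (f a + c a) * exp (- c a) \<ge> exp (f a + c a) - M * c a\<close>.  Summing over \<open>a\<close>, the
  loss is at most \<open>M\<close>, which is the term of the removed element \<open>u\<close>.\<close>

lemma sum_exp_without_max:
  fixes f c :: "'a \<Rightarrow> real"
  assumes fin: "finite A" and u: "u \<in> A"
    and max: "\<And>a. a \<in> A \<Longrightarrow> f a + c a \<le> f u + c u"
    and pos: "\<And>a. a \<in> A \<Longrightarrow> 0 \<le> c a" and sum: "(\<Sum>a\<in>A. c a) \<le> 1"
  shows "(\<Sum>a\<in>A - {u}. exp (f a + c a)) \<le> (\<Sum>a\<in>A. exp (f a))"
proof -
  define M where "M = exp (f u + c u)"
  have term_bound: "exp (f a + c a) - M * c a \<le> exp (f a)" if "a \<in> A" for a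
  proof -
    have "exp (f a + c a) - M * c a \<le> exp (f a + c a) - exp (f a + c a) * c a"
      using max[OF that] pos[OF that] by (simp add: M_def mult_right_mono)
    also have "\<dots> = exp (f a + c a) * (1 + - c a)" by (simp add: algebra_simps)
    also have "\<dots> \<le> exp (f a + c a) * exp (- c a)"
      by (intro mult_left_mono exp_ge_add_one_self) auto
    also have "\<dots> = exp (f a)" by (simp flip: exp_add)
    finally show ?thesis .
  qed
  have "(\<Sum>a\<in>A - {u}. exp (f a + c a)) = (\<Sum>a\<in>A. exp (f a + c a)) - M"
    using fin u by (simp add: sum_diff1 M_def)
  also have "\<dots> \<le> (\<Sum>a\<in>A. exp (f a + c a)) - M * (\<Sum>a\<in>A. c a)"
    using sum by (simp add: M_def)
  also have "\<dots> = (\<Sum>a\<in>A. exp (f a + c a) - M * c a)"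
    by (simp add: sum_subtractf sum_distrib_left)
  also have "\<dots> \<le> (\<Sum>a\<in>A. exp (f a))"
    using term_bound by (rule sum_mono)
  finally show ?thesis .
qed

definition unvisited :: "nat \<Rightarrow> game_state \<Rightarrow> nat set" where
  "unvisited n s = {..<n} - \<Union>(walker_edges s)"

definition potential_on :: "nat \<Rightarrow> nat set \<Rightarrow> edge set \<Rightarrow> real" where
  "potential_on b A G = (\<Sum>u\<in>A. exp (real (degree G u) / (2 * real b)))"

lemma finite_unvisited: "finite (unvisited n s)"
  by (simp add: unvisited_def)

lemma degree_le_of_potential:
  assumes "0 < b" "0 < n" "finite A" "potential_on b A G \<le> real n" "u \<in> A"
  shows "real (degree G u) \<le> 2 * real b * ln (real n)"
proof -
  have "exp (real (degree G u) / (2 * real b)) \<le> potential_on b A G"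
    unfolding potential_on_def using assms(3,5) by (intro member_le_sum) auto
  then have "exp (real (degree G u) / (2 * real b)) \<le> real n" using assms(4) by simp
  then have "real (degree G u) / (2 * real b) \<le> ln (real n)"
    using assms(2) by (subst ln_ge_iff) auto
  then show ?thesis using assms(1) by (simp add: field_simps)
qed

lemma potential_after_breaker_and_removal:
  assumes b: "0 < b" and A: "finite A" and G: "finite G"
    and X: "X \<subseteq> complete_edges n" "card X \<le> b"
    and u: "u \<in> A" and max: "\<And>a. a \<in> A \<Longrightarrow> degree (G \<union> X) a \<le> degree (G \<union> X) u"
  shows "potential_on b (A - {u}) (G \<union> X) \<le> potential_on b A G"
proof -
  have finX: "finite X" using X finite_complete_edges finite_subset by blast
  define f where "f a = real (degree G a) / (2 * real b)" for a
  define c where "c a = real (degree (G \<union> X) a) / (2 * real b) - f a" for a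
  have c_le: "c a \<le> real (degree X a) / (2 * real b)" for a
  proof -
    have "real (degree (G \<union> X) a) \<le> real (degree G a) + real (degree X a)"
      using degree_Un_le[OF G finX, of a] by linarith
    from divide_right_mono[OF this, of "2 * real b"] show ?thesis
      by (simp add: c_def f_def add_divide_distrib)
  qed
  have "(\<Sum>a\<in>A. c a) \<le> (\<Sum>a\<in>A. real (degree X a) / (2 * real b))"
    using c_le by (intro sum_mono)
  also have "\<dots> = real (\<Sum>a\<in>A. degree X a) / (2 * real b)"
    by (simp add: sum_divide_distrib)
  also have "\<dots> \<le> real (2 * b) / (2 * real b)"
    using sum_degree_le[OF X(1) A] X(2) by (intro divide_right_mono of_nat_mono) auto
  also have "\<dots> = 1" using b by simp
  finally have "(\<Sum>a\<in>A. c a) \<le> 1" .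
  moreover have "0 \<le> c a" for a
  proof -
    have "degree G a \<le> degree (G \<union> X) a"
      unfolding degree_def using G finX by (intro card_mono) auto
    then show ?thesis by (simp add: c_def f_def divide_right_mono)
  qed
  moreover have "f a + c a \<le> f u + c u" if "a \<in> A" for a
    using max[OF that] by (simp add: c_def divide_right_mono)
  ultimately have "(\<Sum>a\<in>A - {u}. exp (f a + c a)) \<le> (\<Sum>a\<in>A. exp (f a))"
    using A u by (intro sum_exp_without_max)
  then show ?thesis by (simp add: potential_on_def c_def f_def)
qed

section \<open>The invariants of Walker's strategy\<close>

definition consistent :: "nat \<Rightarrow> game_state \<Rightarrow> bool" where
  "consistent n s \<longleftrightarrow>
     breaker_edges s \<subseteq> complete_edges n \<and> walker_edges s \<subseteq> complete_edges n \<and>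
     breaker_edges s \<inter> walker_edges s = {} \<and> edges_connected (walker_edges s) \<and>
     (case location s of None \<Rightarrow> walker_edges s = {} | Some v \<Rightarrow> v \<in> \<Union>(walker_edges s))"

text \<open>Before her first move, Walker may choose her position; the degree bound on possible positions
  then has to hold for every vertex.\<close>

definition possible_position :: "nat \<Rightarrow> game_state \<Rightarrow> nat \<Rightarrow> bool" where
  "possible_position n s x \<longleftrightarrow> (case location s of None \<Rightarrow> x < n | Some v \<Rightarrow> x = v)"

text \<open>The summand \<open>b\<close> is there because Breaker may have raised the degree of Walker's new
  position in the move just before she went there.  Once all vertices are visited, Walker stays on one edge,
  where Breaker may raise the degree without limit; hence the degree bound is conditional.\<close>

definition breaker_turn_inv :: "nat \<Rightarrow> nat \<Rightarrow> game_state \<Rightarrow> bool" where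
  "breaker_turn_inv n b s \<longleftrightarrow> consistent n s \<and>
     potential_on b (unvisited n s) (breaker_edges s) \<le> real n \<and>
     (unvisited n s \<noteq> {} \<longrightarrow> (\<forall>x. possible_position n s x \<longrightarrow>
        real (degree (breaker_edges s) x) \<le> 2 * real b * ln (real n) + real b))"

text \<open>A move of Breaker may push the potential above \<open>n\<close>; the bound survives only without the largest
  term, whose vertex Walker is about to visit.\<close>

definition walker_turn_inv :: "nat \<Rightarrow> nat \<Rightarrow> game_state \<Rightarrow> bool" where
  "walker_turn_inv n b s \<longleftrightarrow> consistent n s \<and>
     (\<forall>u\<in>unvisited n s.
        (\<forall>a\<in>unvisited n s. degree (breaker_edges s) a \<le> degree (breaker_edges s) u) \<longrightarrow>
        potential_on b (unvisited n s - {u}) (breaker_edges s) \<le> real n) \<and>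
     (\<forall>u\<in>unvisited n s. real (degree (breaker_edges s) u) \<le> 2 * real b * ln (real n) + real b) \<and>
     (unvisited n s \<noteq> {} \<longrightarrow> (\<forall>x. possible_position n s x \<longrightarrow>
        real (degree (breaker_edges s) x) \<le> 2 * real b * ln (real n) + 2 * real b))"

lemma consistent_finite:
  assumes "consistent n s"
  shows "finite (breaker_edges s)" "finite (walker_edges s)"
  using assms finite_subset[OF _ finite_complete_edges] by (auto simp: consistent_def)

lemma breaker_turn_inv_initial:
  assumes "0 < n"
  shows "breaker_turn_inv n b initial_state"
  using assms
  by (simp add: breaker_turn_inv_def consistent_def initial_state_def edges_connected_def
      potential_on_def unvisited_def degree_def)

lemma walker_turn_inv_after_breaker:
  assumes b: "0 < b" and n: "0 < n"
    and inv: "breaker_turn_inv n b s" and legal: "breaker_legal n b s X"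
  shows "walker_turn_inv n b (after_breaker s X)"
proof -
  let ?s = "after_breaker s X"
  have cons: "consistent n s" and pot: "potential_on b (unvisited n s) (breaker_edges s) \<le> real n"
    using inv by (auto simp: breaker_turn_inv_def)
  have X: "X \<subseteq> unclaimed n s" "card X \<le> b" using legal by (auto simp: breaker_legal_def)
  have XK: "X \<subseteq> complete_edges n" using X by (auto simp: unclaimed_def)
  have finX: "finite X" using XK finite_complete_edges finite_subset by blast
  note finB = consistent_finite(1)[OF cons]
  have B: "breaker_edges ?s = breaker_edges s \<union> X" and U: "unvisited n ?s = unvisited n s"
    and pos: "possible_position n ?s = possible_position n s"
    by (simp_all add: after_breaker_def unvisited_def possible_position_def fun_eq_iff)
  have cons': "consistent n ?s"
    using cons X(1) by (auto simp: consistent_def after_breaker_def unclaimed_def split: option.splits)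
  have deg: "real (degree (breaker_edges ?s) x) \<le> real (degree (breaker_edges s) x) + real b" for x
    using degree_Un_le[OF finB finX, of x] degree_le_card[OF finX, of x] X(2) unfolding B by linarith
  have "real (degree (breaker_edges ?s) u) \<le> 2 * real b * ln (real n) + real b"
    if "u \<in> unvisited n s" for u
    using deg[of u] degree_le_of_potential[OF b n finite_unvisited pot that] by simp
  moreover have "real (degree (breaker_edges ?s) x) \<le> 2 * real b * ln (real n) + 2 * real b"
    if "unvisited n s \<noteq> {}" "possible_position n s x" for x
  proof -
    have "real (degree (breaker_edges s) x) \<le> 2 * real b * ln (real n) + real b"
      using inv that by (auto simp: breaker_turn_inv_def)
    with deg[of x] show ?thesis by linarith
  qed
  moreover have "potential_on b (unvisited n s - {u}) (breaker_edges ?s) \<le> real n"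
    if "u \<in> unvisited n s"
      "\<forall>a\<in>unvisited n s. degree (breaker_edges ?s) a \<le> degree (breaker_edges ?s) u" for u
    using potential_after_breaker_and_removal[OF b finite_unvisited finB XK X(2) that(1)]
      that(2) pot unfolding B by force
  ultimately show ?thesis using cons' unfolding walker_turn_inv_def U pos by blast
qed

lemma exists_walker_move:
  assumes n: "4 * real b * ln (real n) + 3 * real b + 2 < real n"
    and inv: "walker_turn_inv n b s" and n2: "2 \<le> n"
  shows "\<exists>m. walker_legal n s m \<and> breaker_turn_inv n b (after_walker s m)"
proof (cases "unvisited n s = {}")
  have cons: "consistent n s" using inv by (simp add: walker_turn_inv_def)
  case True
  \<comment> \<open>Everything is visited: Walker goes back and forth on one of her own edges.\<close>
  then have "{..<n} \<subseteq> \<Union>(walker_edges s)" by (simp add: unvisited_def)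
  then have "0 \<in> \<Union>(walker_edges s)" by (rule subsetD) (use n2 in simp)
  then obtain v where v: "location s = Some v" "v \<in> \<Union>(walker_edges s)"
    using cons by (auto simp: consistent_def split: option.splits)
  then obtain e where e: "e \<in> walker_edges s" "v \<in> e" by blast
  then have "e \<in> complete_edges n" using cons by (auto simp: consistent_def)
  then obtain y where y: "e = {v, y}"
    using e(2) by (auto simp: complete_edges_def insert_commute)
  have edge: "{v, y} \<in> walker_edges s" "{y, v} \<in> walker_edges s"
    using e y by (auto simp: insert_commute)
  then have "walker_legal n s (Walk v y v)"
    using cons v(1) by (auto simp: consistent_def)
  moreover have "after_walker s (Walk v y v) = s"
    using edge v(1) by (simp add: insert_absorb)
  moreover have "breaker_turn_inv n b s"
    using cons True by (simp add: breaker_turn_inv_def potential_on_def)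
  ultimately show ?thesis by metis
next
  have cons: "consistent n s" using inv by (simp add: walker_turn_inv_def)
  let ?B = "breaker_edges s" and ?W = "walker_edges s" and ?U = "unvisited n s"
  note finB = consistent_finite(1)[OF cons]
  case False
  have "Max (degree ?B ` ?U) \<in> degree ?B ` ?U"
    using False finite_unvisited by (intro Max_in) auto
  then obtain u where u: "u \<in> ?U" "degree ?B u = Max (degree ?B ` ?U)" by auto
  have max: "\<forall>a\<in>?U. degree ?B a \<le> degree ?B u"
    using u(2) finite_unvisited by simp
  have un: "u < n" "u \<notin> \<Union>?W" using u(1) by (auto simp: unvisited_def)
  obtain x where x: "possible_position n s x" "x \<noteq> u" "x < n" "x \<in> \<Union>?W \<or> ?W = {}"
  proof (cases "location s")
    case None
    have "\<exists>x<n. x \<noteq> u" using n2 by (intro exI[of _ "if u = 0 then 1 else 0"]) auto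
    then show ?thesis using that None cons by (auto simp: possible_position_def consistent_def)
  next
    case (Some v)
    then have v: "v \<in> \<Union>?W" using cons by (simp add: consistent_def)
    moreover have "v < n" using v cons by (auto simp: consistent_def complete_edges_def)
    ultimately show ?thesis using that[of v] un Some by (auto simp: possible_position_def)
  qed
  have deg_u: "real (degree ?B u) \<le> 2 * real b * ln (real n) + real b"
    using inv u(1) by (simp add: walker_turn_inv_def)
  have deg_x: "real (degree ?B x) \<le> 2 * real b * ln (real n) + 2 * real b"
    using inv False x(1) by (simp add: walker_turn_inv_def)
  have "real (degree ?B x + degree ?B u + 2) < real n"
    using deg_u deg_x n by simp
  then have "degree ?B x + degree ?B u + 2 < n" by (simp only: of_nat_less_iff)
  from common_free_neighbour[OF finB this] obtain w
    where w: "w < n" "w \<noteq> x" "w \<noteq> u" "{x, w} \<notin> ?B" "{w, u} \<notin> ?B" by blast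
  have legal: "walker_legal n s (Walk x w u)"
    using x w un by (auto simp: complete_edges_iff possible_position_def split: option.splits)
  let ?s = "after_walker s (Walk x w u)"
  have W: "walker_edges ?s = insert {w, u} (insert {x, w} ?W)" by auto
  have "edges_connected (walker_edges ?s)"
    unfolding W using cons x(4) by (intro edges_connected_insert) (auto simp: consistent_def)
  then have cons': "consistent n ?s"
    using cons legal by (auto simp: consistent_def)
  have sub: "unvisited n ?s \<subseteq> ?U - {u}" by (auto simp: unvisited_def)
  have "potential_on b (unvisited n ?s) ?B \<le> potential_on b (?U - {u}) ?B"
    unfolding potential_on_def using sub finite_unvisited[of n s] by (intro sum_mono2) auto
  also have "\<dots> \<le> real n" using inv u(1) max by (simp add: walker_turn_inv_def)
  finally have "breaker_turn_inv n b ?s"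
    using cons' deg_u by (simp add: breaker_turn_inv_def possible_position_def)
  with legal show ?thesis by blast
qed

lemma spanning_tree_at_end:
  assumes cons: "consistent n s" and over: "unclaimed n s = {}"
    and deg: "\<And>u. u \<in> unvisited n s \<Longrightarrow> degree (breaker_edges s) u + 1 < n"
  shows "\<exists>T\<in>spanning_trees n. T \<subseteq> walker_edges s"
proof -
  have "unvisited n s = {}"
  proof (rule ccontr)
    assume "unvisited n s \<noteq> {}"
    then obtain u where u: "u \<in> unvisited n s" by blast
    have "{..<n} - {u} \<subseteq> {w. {u, w} \<in> breaker_edges s}"
    proof
      fix w assume "w \<in> {..<n} - {u}"
      then have "{u, w} \<in> complete_edges n" using u by (auto simp: complete_edges_iff unvisited_def)
      moreover have "{u, w} \<notin> walker_edges s" using u by (auto simp: unvisited_def)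
      ultimately show "w \<in> {w. {u, w} \<in> breaker_edges s}" using over by (auto simp: unclaimed_def)
    qed
    then have "card ({..<n} - {u}) \<le> card {w. {u, w} \<in> breaker_edges s}"
      using finite_neighbours[OF consistent_finite(1)[OF cons]] by (intro card_mono)
    also have "\<dots> \<le> degree (breaker_edges s) u"
      using card_neighbours_le_degree[OF consistent_finite(1)[OF cons]] .
    finally show False using deg[OF u] u by (simp add: unvisited_def)
  qed
  then have visited: "u \<in> \<Union>(walker_edges s)" if "u < n" for u
    using that by (auto simp: unvisited_def)
  have "edges_connected (walker_edges s)" using cons by (simp add: consistent_def)
  then have "(u, v) \<in> (adj (walker_edges s))\<^sup>*" if "u < n" "v < n" for u v
    using visited[OF that(1)] visited[OF that(2)] unfolding edges_connected_def by blast
  then have "connected_on n (walker_edges s)" by (simp add: connected_on_def)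
  then show ?thesis
    using cons consistent_finite(2)[OF cons]
    by (intro spanning_tree_of_connected) (auto simp: consistent_def)
qed

lemma walker_wins_if_bias_small:
  assumes b: "0 < b" and n: "4 * real b * ln (real n) + 3 * real b + 2 < real n" and n2: "2 \<le> n"
  shows "\<exists>S. winning_strategy n b (spanning_trees n) S"
proof (rule winning_strategy_if_invariant[where P = "breaker_turn_inv n b" and Q = "walker_turn_inv n b"])
  show "breaker_turn_inv n b initial_state" using n2 by (intro breaker_turn_inv_initial) simp
next
  fix s X assume "breaker_turn_inv n b s" "breaker_legal n b s X"
  then show "walker_turn_inv n b (after_breaker s X)"
    using b n2 by (intro walker_turn_inv_after_breaker) auto
next
  fix s assume "walker_turn_inv n b s"
  then show "\<exists>m. walker_legal n s m \<and> breaker_turn_inv n b (after_walker s m)"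
    using n n2 by (intro exists_walker_move)
next
  fix s assume inv: "breaker_turn_inv n b s \<or> walker_turn_inv n b s" and "unclaimed n s = {}"
  have deg: "real (degree (breaker_edges s) u) \<le> 2 * real b * ln (real n) + real b"
    if "u \<in> unvisited n s" for u
    using inv
  proof
    assume "breaker_turn_inv n b s"
    then have "real (degree (breaker_edges s) u) \<le> 2 * real b * ln (real n)"
      using b n2 that finite_unvisited
      by (intro degree_le_of_potential[of b n "unvisited n s"]) (auto simp: breaker_turn_inv_def)
    then show ?thesis by simp
  qed (use that in \<open>simp add: walker_turn_inv_def\<close>)
  have "0 \<le> real b * ln (real n)" using n2 by simp
  with deg n have "real (degree (breaker_edges s) u + 1) < real n" if "u \<in> unvisited n s" for u
    using deg[OF that] by simp
  then have "degree (breaker_edges s) u + 1 < n" if "u \<in> unvisited n s" for u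
    using that by (simp only: of_nat_less_iff)
  then show "\<exists>T\<in>spanning_trees n. T \<subseteq> walker_edges s"
    using inv \<open>unclaimed n s = {}\<close>
    by (intro spanning_tree_at_end) (auto simp: breaker_turn_inv_def walker_turn_inv_def)
qed

section \<open>Walker's win\<close>

theorem theorem1p3:
  fixes \<epsilon> :: real
  assumes "0 < \<epsilon>" and "\<epsilon> < 1 / 4"
  shows "\<exists>n0 :: nat. \<forall>n\<ge>n0. \<forall>b :: nat.
           0 < b \<and> real b \<le> (1 / 4 - \<epsilon>) * (real n / ln (real n)) \<longrightarrow>
           (\<exists>S. winning_strategy n b (spanning_trees n) S)"
proof -
  \<comment> \<open>Since \<open>b \<le> n / (4 * ln n)\<close>, this sequence bounds \<open>(3 * b + 2) / n\<close>, and the slack left by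
    \<open>4 * b * ln n \<le> (1 - 4 * \<epsilon>) * n\<close> is \<open>4 * \<epsilon>\<close>.\<close>
  have "(\<lambda>n. 3 / 4 * inverse (ln (real n)) + 2 * inverse (real n)) \<longlonglongrightarrow> 3 / 4 * 0 + 2 * 0"
    by (intro tendsto_intros tendsto_inverse_0_at_top filterlim_real_sequentially
        filterlim_compose[OF ln_at_top filterlim_real_sequentially])
  from order_tendstoD(2)[OF this, of "4 * \<epsilon>"]
  have "\<forall>\<^sub>F n in sequentially. 3 / 4 * inverse (ln (real n)) + 2 * inverse (real n) < 4 * \<epsilon>"
    using assms(1) by simp
  then obtain n1 where
    n1: "\<And>n. n \<ge> n1 \<Longrightarrow> 3 / 4 * inverse (ln (real n)) + 2 * inverse (real n) < 4 * \<epsilon>"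
    by (auto simp: eventually_sequentially)
  have "\<exists>S. winning_strategy n b (spanning_trees n) S"
    if n: "n \<ge> max 2 n1" and b: "0 < b" "real b \<le> (1 / 4 - \<epsilon>) * (real n / ln (real n))"
    for n b :: nat
  proof (rule walker_wins_if_bias_small)
    have ln_pos: "0 < ln (real n)" and n_pos: "0 < real n" using n by auto
    have main: "4 * real b * ln (real n) \<le> (1 - 4 * \<epsilon>) * real n"
      using b(2) ln_pos by (simp add: field_simps)
    have "real b \<le> 1 / 4 * (real n / ln (real n))"
      using assms(1) ln_pos n_pos by (intro order_trans[OF b(2)] mult_right_mono) auto
    then have "3 * real b + 2 \<le> 3 * (1 / 4 * (real n / ln (real n))) + 2" by linarith
    also have "\<dots> = (3 / 4 * inverse (ln (real n)) + 2 * inverse (real n)) * real n"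
      using n_pos ln_pos by (simp add: field_simps)
    also have "\<dots> < 4 * \<epsilon> * real n"
      using n1[of n] n n_pos by (intro mult_strict_right_mono) auto
    finally show "4 * real b * ln (real n) + 3 * real b + 2 < real n"
      using main by (simp add: algebra_simps)
  qed (use n b in auto)
  then show ?thesis by blast
qed

end
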